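(* Let $\lambda\in\mathbf{k}$. The quintuple $(\mathrm{ADF},m,\bullet,\Delta,\epsilon)$, where $m_{X,Y}(F\otimes G)=F\diamond G$, is a twisted bialgebra.
   Context: $\mathbf{k}$ is a field of characteristic zero. Species: functors from finite sets with bijections to $\mathbf{k}$-vector spaces; Cauchy product $(P\otimes Q)[X]=\bigoplus_{X_1\sqcup X_2=X}P[X_1]\otimes Q[X_2]$; $1_{\mathbf{k}}$ has $1_{\mathbf{k}}[\emptyset]=\mathbf{k}$ and $0$ elsewhere. A twisted algebra is a species with natural, associative, unital products $m_{X,Y}:P[X]\otimes P[Y]\to P[X\sqcup Y]$; if $P,Q$ are twisted algebras, $P\otimes Q$ is a twisted algebra with $(p_1\otimes q_1)(p_2\otimes q_2)=p_1p_2\otimes q_1q_2$. A twisted coalgebra is a species with morphisms $\Delta:P\to P\otimes P$, $\varepsilon:P\to1_{\mathbf{k}}$ that are coassociative and counital. A twisted bialgebra is a twisted algebra $(P,m,1_P)$ that is also a twisted coalgebra $(P,\Delta,\varepsilon)$ such that $\Delta$ and $\varepsilon$ are morphisms of twisted algebras. A Rota–Baxter species of weight $\lambda$ is a twisted algebra with a morphism $R$ satisfying $m_{X,Y}(R_Xx\otimes R_Yy)=R_{X\sqcup Y}m_{X,Y}(R_Xx\otimes y+x\otimes R_Yy+\lambda x\otimes y)$; morphisms of Rota–Baxter species preserve product, unit and operator. For a finite set $X$, $\mathrm{ADF}[X]$ has basis the planar rooted forests with exactly $|X|$ angles (gaps between consecutive leaves, inside a tree or between adjacent trees) decorated bijectively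 by $X$, written $T_1x_1\cdots x_mT_{m+1}$; $\bullet$ is the one-vertex tree and $\bullet x\bullet$ is two one-vertex trees separated by an angle decorated $x$. $R_X=B^+$ adds a new root joined to all roots. The product $\diamond$ (weight $\lambda$) is defined bilinearly by induction on depth: for trees $\bullet\diamond T'=T'$, $T\diamond\bullet=T$, $B^+(A)\diamond B^+(A')=B^+(B^+(A)\diamond A')+B^+(A\diamond B^+(A'))+\lambda B^+(A\diamond A')$; for forests $F\diamond G=T_1x_1\cdots x_m(T_{m+1}\diamond T'_1)y_1\cdots y_nT'_{n+1}$. $(\mathrm{ADF},\diamond,\bullet,B^+)$ is the free Rota–Baxter species of weight $\lambda$ on the species $O$ with $O[\{x\}]=\mathbf{k}\bullet x\bullet$ and $O[X]=0$ for non-singletons. $\epsilon:\mathrm{ADF}\to1_{\mathbf{k}}$: $\epsilon_\emptyset(\bullet)=1$, $\epsilon_X(F)=0$ for all other basis forests. $\mathrm{ADF}\otimes\mathrm{ADF}$ is the Rota–Baxter species with componentwise product and operator $R^{(2)}_X(F\otimes G)=B^+(F)\otimes G+\epsilon_{X_1}(F)\bullet\otimes B^+(G)$ for $F\in\mathrm{ADF}[X_1]$, $G\in\mathrm{ADF}[X\setminus X_1]$. $\Delta:\mathrm{ADF}\to\mathrm{ADF}\otimes\mathrm{ADF}$ is the unique morphism of Rota–Baxter species with $\Delta_{\{x\}}(\bullet x\bullet)=\bullet x\bullet\otimes\bullet+\bullet\otimes\bullet x\bullet$ for every singleton $\{x\}$. *)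

theory Defs
  imports Main "HOL-Library.Poly_Mapping"
begin

section \<open>Free vector spaces\<close>

text \<open>
  The \<open>'k\<close>-vector space with basis \<open>B :: 'b set\<close> is the space of all \<open>v :: 'b \<Rightarrow>\<^sub>0 'k\<close> with
  \<open>keys v \<subseteq> B\<close>; the basis vector of \<open>b\<close> is \<open>single b 1\<close>. A linear map out of such a space is given
  by its values \<open>f :: 'b \<Rightarrow> ('c \<Rightarrow>\<^sub>0 'k)\<close> on the basis, and the map itself is \<open>linext f\<close>. The tensor
  product of the spaces with bases \<open>B\<close> and \<open>C\<close> is the space with basis \<open>B \<times> C\<close>.
\<close>

definition basis_vec :: "'b \<Rightarrow> 'b \<Rightarrow>\<^sub>0 'k::field"
  where "basis_vec b = Poly_Mapping.single b 1"

definition scale :: "'k::field \<Rightarrow> ('b \<Rightarrow>\<^sub>0 'k) \<Rightarrow> ('b \<Rightarrow>\<^sub>0 'k)"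
  where "scale c v = Poly_Mapping.map ((*) c) v"

definition linext :: "('a \<Rightarrow> 'b \<Rightarrow>\<^sub>0 'k::field) \<Rightarrow> ('a \<Rightarrow>\<^sub>0 'k) \<Rightarrow> ('b \<Rightarrow>\<^sub>0 'k)"
  where "linext f v = (\<Sum>a\<in>Poly_Mapping.keys v. scale (Poly_Mapping.lookup v a) (f a))"

definition tensor :: "('a \<Rightarrow>\<^sub>0 'k::field) \<Rightarrow> ('b \<Rightarrow>\<^sub>0 'k) \<Rightarrow> ('a \<times> 'b \<Rightarrow>\<^sub>0 'k)"
  where "tensor v w = linext (\<lambda>a. linext (\<lambda>b. basis_vec (a, b)) w) v"

definition tensor_map ::
    "('a \<Rightarrow> 'c \<Rightarrow>\<^sub>0 'k::field) \<Rightarrow> ('b \<Rightarrow> 'd \<Rightarrow>\<^sub>0 'k) \<Rightarrow> ('a \<times> 'b \<Rightarrow> 'c \<times> 'd \<Rightarrow>\<^sub>0 'k)"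
  where "tensor_map f g = (\<lambda>(a, b). tensor (f a) (g b))"


section \<open>Species\<close>

text \<open>
  The finite sets are the finite subsets of a type \<open>'x\<close>. Each \<open>P[X]\<close> is the vector space with
  basis \<open>basis P X\<close> (every vector space has a basis, and \<open>P[\<sigma>]\<close> is not required to permute it).
  The bases for different \<open>X\<close> are taken to be disjoint, so that a family of linear maps indexed by
  the finite sets is the same as one function on basis elements, and the direct sum over
  decompositions in the Cauchy product needs no tags. A bijection \<open>\<sigma> : X \<rightarrow> Y\<close> is given by a
  function on \<open>'x\<close> of which only the restriction to \<open>X\<close> matters.
\<close>

record (overloaded) ('x, 'b, 'k) species =
  basis :: "'x set \<Rightarrow> 'b set"
  transport :: "('x \<Rightarrow> 'x) \<Rightarrow> 'b \<Rightarrow> 'b \<Rightarrow>\<^sub>0 ('k::field)"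

definition component :: "('x, 'b, 'k::field) species \<Rightarrow> 'x set \<Rightarrow> ('b \<Rightarrow>\<^sub>0 'k) set"
  where "component P X = {v. Poly_Mapping.keys v \<subseteq> basis P X}"

definition is_species :: "('x, 'b, 'k::field) species \<Rightarrow> bool"
  where "is_species P \<longleftrightarrow>
    (\<forall>X Y. finite X \<longrightarrow> finite Y \<longrightarrow> X \<noteq> Y \<longrightarrow> basis P X \<inter> basis P Y = {}) \<and>
    (\<forall>X Y \<sigma>. finite X \<longrightarrow> bij_betw \<sigma> X Y \<longrightarrow>
      (\<forall>b\<in>basis P X. transport P \<sigma> b \<in> component P Y)) \<and>
    (\<forall>X \<sigma> \<tau>. finite X \<longrightarrow> inj_on \<sigma> X \<longrightarrow> (\<forall>x\<in>X. \<sigma> x = \<tau> x) \<longrightarrow>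
      (\<forall>b\<in>basis P X. transport P \<sigma> b = transport P \<tau> b)) \<and>
    (\<forall>X. finite X \<longrightarrow> (\<forall>v\<in>component P X. linext (transport P id) v = v)) \<and>
    (\<forall>X Y Z \<sigma> \<tau>. finite X \<longrightarrow> bij_betw \<sigma> X Y \<longrightarrow> bij_betw \<tau> Y Z \<longrightarrow>
      (\<forall>v\<in>component P X. linext (transport P (\<tau> \<circ> \<sigma>)) v
        = linext (transport P \<tau>) (linext (transport P \<sigma>) v)))"

definition species_morphism ::
    "('x, 'b, 'k::field) species \<Rightarrow> ('x, 'c, 'k) species \<Rightarrow> ('b \<Rightarrow> 'c \<Rightarrow>\<^sub>0 'k) \<Rightarrow> bool"
  where "species_morphism P Q f \<longleftrightarrow>
    (\<forall>X. finite X \<longrightarrow> (\<forall>b\<in>basis P X. f b \<in> component Q X)) \<and>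
    (\<forall>X Y \<sigma>. finite X \<longrightarrow> bij_betw \<sigma> X Y \<longrightarrow>
      (\<forall>v\<in>component P X. linext f (linext (transport P \<sigma>) v)
        = linext (transport Q \<sigma>) (linext f v)))"

definition cauchy ::
    "('x, 'b, 'k::field) species \<Rightarrow> ('x, 'c, 'k) species \<Rightarrow> ('x, 'b \<times> 'c, 'k) species"
    (infixr \<open>\<otimes>\<^sub>S\<close> 70)
  where "P \<otimes>\<^sub>S Q =
    \<lparr> basis = (\<lambda>X. \<Union>{basis P X1 \<times> basis Q X2 | X1 X2. X1 \<union> X2 = X \<and> X1 \<inter> X2 = {}}),
      transport = (\<lambda>\<sigma>. tensor_map (transport P \<sigma>) (transport Q \<sigma>)) \<rparr>"

definition unit_species :: "('x, unit, 'k::field) species"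
  where "unit_species =
    \<lparr> basis = (\<lambda>X. if X = {} then {()} else {}), transport = (\<lambda>\<sigma>. basis_vec) \<rparr>"


section \<open>Twisted algebras, coalgebras and bialgebras\<close>

definition times_by :: "('b \<times> 'b \<Rightarrow> 'b \<Rightarrow>\<^sub>0 'k::field) \<Rightarrow> ('b \<Rightarrow>\<^sub>0 'k) \<Rightarrow> ('b \<Rightarrow>\<^sub>0 'k) \<Rightarrow> ('b \<Rightarrow>\<^sub>0 'k)"
  where "times_by m x y = linext m (tensor x y)"

definition twisted_algebra ::
    "('x, 'b, 'k::field) species \<Rightarrow> ('b \<times> 'b \<Rightarrow> 'b \<Rightarrow>\<^sub>0 'k) \<Rightarrow> ('b \<Rightarrow>\<^sub>0 'k) \<Rightarrow> bool"
  where "twisted_algebra P m u \<longleftrightarrow>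
    is_species P \<and> species_morphism (P \<otimes>\<^sub>S P) P m \<and> u \<in> component P {} \<and>
    (\<forall>X Y Z. finite X \<longrightarrow> finite Y \<longrightarrow> finite Z \<longrightarrow>
      X \<inter> Y = {} \<longrightarrow> X \<inter> Z = {} \<longrightarrow> Y \<inter> Z = {} \<longrightarrow>
      (\<forall>x\<in>component P X. \<forall>y\<in>component P Y. \<forall>z\<in>component P Z.
        times_by m (times_by m x y) z = times_by m x (times_by m y z))) \<and>
    (\<forall>X. finite X \<longrightarrow> (\<forall>x\<in>component P X. times_by m u x = x \<and> times_by m x u = x))"

definition twisted_algebra_morphism ::
    "('x, 'b, 'k::field) species \<Rightarrow> ('b \<times> 'b \<Rightarrow> 'b \<Rightarrow>\<^sub>0 'k) \<Rightarrow> ('b \<Rightarrow>\<^sub>0 'k) \<Rightarrow>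
     ('x, 'c, 'k) species \<Rightarrow> ('c \<times> 'c \<Rightarrow> 'c \<Rightarrow>\<^sub>0 'k) \<Rightarrow> ('c \<Rightarrow>\<^sub>0 'k) \<Rightarrow>
     ('b \<Rightarrow> 'c \<Rightarrow>\<^sub>0 'k) \<Rightarrow> bool"
  where "twisted_algebra_morphism P m u Q m' u' f \<longleftrightarrow>
    species_morphism P Q f \<and> linext f u = u' \<and>
    (\<forall>X Y. finite X \<longrightarrow> finite Y \<longrightarrow> X \<inter> Y = {} \<longrightarrow>
      (\<forall>x\<in>component P X. \<forall>y\<in>component P Y.
        linext f (times_by m x y) = times_by m' (linext f x) (linext f y)))"

definition cauchy_mult ::
    "('b \<times> 'b \<Rightarrow> 'b \<Rightarrow>\<^sub>0 'k::field) \<Rightarrow> ('c \<times> 'c \<Rightarrow> 'c \<Rightarrow>\<^sub>0 'k) \<Rightarrow>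
     (('b \<times> 'c) \<times> ('b \<times> 'c) \<Rightarrow> 'b \<times> 'c \<Rightarrow>\<^sub>0 'k)"
  where "cauchy_mult m m' = (\<lambda>((p1, q1), (p2, q2)). tensor (m (p1, p2)) (m' (q1, q2)))"

definition unit_species_mult :: "unit \<times> unit \<Rightarrow> unit \<Rightarrow>\<^sub>0 'k::field"
  where "unit_species_mult = (\<lambda>_. basis_vec ())"

text \<open>
  The three equations are coassociativity and the two counit laws, modulo the identifications of
  \<open>(P \<otimes>\<^sub>S P) \<otimes>\<^sub>S P\<close> with \<open>P \<otimes>\<^sub>S (P \<otimes>\<^sub>S P)\<close> and of \<open>unit_species \<otimes>\<^sub>S P\<close>, \<open>P \<otimes>\<^sub>S unit_species\<close> with \<open>P\<close>.
\<close>

definition twisted_coalgebra ::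
    "('x, 'b, 'k::field) species \<Rightarrow> ('b \<Rightarrow> 'b \<times> 'b \<Rightarrow>\<^sub>0 'k) \<Rightarrow> ('b \<Rightarrow> unit \<Rightarrow>\<^sub>0 'k) \<Rightarrow> bool"
  where "twisted_coalgebra P \<Delta> \<epsilon> \<longleftrightarrow>
    is_species P \<and> species_morphism P (P \<otimes>\<^sub>S P) \<Delta> \<and> species_morphism P unit_species \<epsilon> \<and>
    (\<forall>X. finite X \<longrightarrow> (\<forall>v\<in>component P X.
      linext (\<lambda>((a, b), c). basis_vec (a, (b, c))) (linext (tensor_map \<Delta> basis_vec) (linext \<Delta> v))
        = linext (tensor_map basis_vec \<Delta>) (linext \<Delta> v) \<and>
      linext (\<lambda>(_, b). basis_vec b) (linext (tensor_map \<epsilon> basis_vec) (linext \<Delta> v)) = v \<and>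
      linext (\<lambda>(a, _). basis_vec a) (linext (tensor_map basis_vec \<epsilon>) (linext \<Delta> v)) = v))"

definition twisted_bialgebra ::
    "('x, 'b, 'k::field) species \<Rightarrow> ('b \<times> 'b \<Rightarrow> 'b \<Rightarrow>\<^sub>0 'k) \<Rightarrow> ('b \<Rightarrow>\<^sub>0 'k) \<Rightarrow>
     ('b \<Rightarrow> 'b \<times> 'b \<Rightarrow>\<^sub>0 'k) \<Rightarrow> ('b \<Rightarrow> unit \<Rightarrow>\<^sub>0 'k) \<Rightarrow> bool"
  where "twisted_bialgebra P m u \<Delta> \<epsilon> \<longleftrightarrow>
    twisted_algebra P m u \<and> twisted_coalgebra P \<Delta> \<epsilon> \<and>
    twisted_algebra_morphism P m u (P \<otimes>\<^sub>S P) (cauchy_mult m m) (tensor u u) \<Delta> \<and>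
    twisted_algebra_morphism P m u unit_species unit_species_mult (basis_vec ()) \<epsilon>"

definition rota_baxter_morphism ::
    "('x, 'b, 'k::field) species \<Rightarrow> ('b \<times> 'b \<Rightarrow> 'b \<Rightarrow>\<^sub>0 'k) \<Rightarrow> ('b \<Rightarrow>\<^sub>0 'k) \<Rightarrow> ('b \<Rightarrow> 'b \<Rightarrow>\<^sub>0 'k) \<Rightarrow>
     ('x, 'c, 'k) species \<Rightarrow> ('c \<times> 'c \<Rightarrow> 'c \<Rightarrow>\<^sub>0 'k) \<Rightarrow> ('c \<Rightarrow>\<^sub>0 'k) \<Rightarrow> ('c \<Rightarrow> 'c \<Rightarrow>\<^sub>0 'k) \<Rightarrow>
     ('b \<Rightarrow> 'c \<Rightarrow>\<^sub>0 'k) \<Rightarrow> bool"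
  where "rota_baxter_morphism P m u R Q m' u' R' f \<longleftrightarrow>
    twisted_algebra_morphism P m u Q m' u' f \<and>
    (\<forall>X. finite X \<longrightarrow> (\<forall>v\<in>component P X. linext f (linext R v) = linext R' (linext f v)))"


section \<open>Angularly decorated forests\<close>

text \<open>
  A forest \<open>T\<^sub>1 x\<^sub>1 \<dots> x\<^sub>m T\<^sub>m\<^sub>+\<^sub>1\<close> is \<open>Angle T\<^sub>1 x\<^sub>1 (\<dots> (Single T\<^sub>m\<^sub>+\<^sub>1))\<close>, and \<open>Graft F\<close> is the tree
  obtained from the forest \<open>F\<close> by adding a root. The gap between the last leaf of a tree and the
  first leaf of the next tree is stored between these two trees, so every gap between consecutive
  leaves is stored exactly once, and \<open>angles\<close> lists the decorations from left to right.
\<close>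

datatype 'x tree = Leaf | Graft "'x forest"
and 'x forest = Single "'x tree" | Angle "'x tree" 'x "'x forest"

primrec tree_angles :: "'x tree \<Rightarrow> 'x list" and angles :: "'x forest \<Rightarrow> 'x list" where
  "tree_angles Leaf = []"
| "tree_angles (Graft F) = angles F"
| "angles (Single T) = tree_angles T"
| "angles (Angle T x F) = tree_angles T @ x # angles F"

definition ADF :: "('x, 'x forest, 'k::field) species"
  where "ADF =
    \<lparr> basis = (\<lambda>X. {F. distinct (angles F) \<and> set (angles F) = X}),
      transport = (\<lambda>\<sigma> F. basis_vec (map_forest \<sigma> F)) \<rparr>"

definition bullet :: "'x forest"
  where "bullet = Single Leaf"

definition bullet2 :: "'x \<Rightarrow> 'x forest"
  where "bullet2 x = Angle Leaf x (Single Leaf)"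

definition B_plus :: "'x forest \<Rightarrow> 'x forest \<Rightarrow>\<^sub>0 'k::field"
  where "B_plus F = basis_vec (Single (Graft F))"

text \<open>
  The product of two basis trees is a combination of trees. The argument \<open>w\<close> is the weight.
\<close>

function (sequential) diamond_tree :: "'k::field \<Rightarrow> 'x tree \<Rightarrow> 'x tree \<Rightarrow> 'x tree \<Rightarrow>\<^sub>0 'k"
  and diamond :: "'k \<Rightarrow> 'x forest \<Rightarrow> 'x forest \<Rightarrow> 'x forest \<Rightarrow>\<^sub>0 'k" where
  "diamond_tree w Leaf T' = basis_vec T'"
| "diamond_tree w T Leaf = basis_vec T"
| "diamond_tree w (Graft A) (Graft A') =
     linext (\<lambda>F. basis_vec (Graft F)) (diamond w (Single (Graft A)) A')
   + linext (\<lambda>F. basis_vec (Graft F)) (diamond w A (Single (Graft A')))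
   + scale w (linext (\<lambda>F. basis_vec (Graft F)) (diamond w A A'))"
| "diamond w (Angle T x F) G = linext (\<lambda>H. basis_vec (Angle T x H)) (diamond w F G)"
| "diamond w (Single T) (Single T') = linext (\<lambda>S. basis_vec (Single S)) (diamond_tree w T T')"
| "diamond w (Single T) (Angle T' y G) =
     linext (\<lambda>S. basis_vec (Angle S y G)) (diamond_tree w T T')"
  by pat_completeness auto
termination
  by (relation "measure (\<lambda>z. case z of
        Inl (w, T, T') \<Rightarrow> 2 * (size T + size T') + 1
      | Inr (w, F, G) \<Rightarrow> 2 * (size F + size G))") auto

definition ADF_mult :: "'k::field \<Rightarrow> 'x forest \<times> 'x forest \<Rightarrow> 'x forest \<Rightarrow>\<^sub>0 'k"
  where "ADF_mult w = (\<lambda>(F, G). diamond w F G)"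

definition ADF_counit :: "'x forest \<Rightarrow> unit \<Rightarrow>\<^sub>0 'k::field"
  where "ADF_counit F = (if F = bullet then basis_vec () else 0)"

definition ADF2_operator :: "'x forest \<times> 'x forest \<Rightarrow> 'x forest \<times> 'x forest \<Rightarrow>\<^sub>0 'k::field"
  where "ADF2_operator = (\<lambda>(F, G).
    tensor (B_plus F) (basis_vec G)
    + scale (Poly_Mapping.lookup (ADF_counit F) ()) (tensor (basis_vec bullet) (B_plus G)))"

text \<open>
  A morphism out of \<open>ADF\<close> is determined by its values on the forests with pairwise different
  decorations; on the remaining elements of the type the function is fixed to be zero.
\<close>

definition ADF_coproduct :: "'k::field \<Rightarrow> 'x forest \<Rightarrow> 'x forest \<times> 'x forest \<Rightarrow>\<^sub>0 'k"
  where "ADF_coproduct w = (THE \<Delta>.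
    rota_baxter_morphism
      ADF (ADF_mult w) (basis_vec bullet) B_plus
      (ADF \<otimes>\<^sub>S ADF) (cauchy_mult (ADF_mult w) (ADF_mult w))
        (tensor (basis_vec bullet) (basis_vec bullet)) ADF2_operator
      \<Delta> \<and>
    (\<forall>x. \<Delta> (bullet2 x)
      = tensor (basis_vec (bullet2 x)) (basis_vec bullet)
      + tensor (basis_vec bullet) (basis_vec (bullet2 x))) \<and>
    (\<forall>F. \<not> distinct (angles F) \<longrightarrow> \<Delta> F = 0))"

end

theory Submission
  imports Defs "HOL-Library.Multiset"
begin

text \<open>
  Define a map recursively on all forests by \<open>cop (B\<^sup>+ F) = R\<^sup>(\<^sup>2\<^sup>) (cop F)\<close> and
  \<open>cop (T x F) = cop T \<cdot> (\<bullet>x\<bullet> \<otimes> \<bullet> + \<bullet> \<otimes> \<bullet>x\<bullet>) \<cdot> cop F\<close>. Since the counit is multiplicative and kills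
  the image of \<open>B\<^sup>+\<close>, the operator \<open>R\<^sup>(\<^sup>2\<^sup>)\<close> is Rota-Baxter, and induction on the sizes of two forests
  shows that \<open>cop\<close> is multiplicative. As \<open>T x F = T \<diamond> (\<bullet>x\<bullet>) \<diamond> F\<close>, a Rota-Baxter morphism is determined
  by its values on the \<open>\<bullet>x\<bullet>\<close>, so \<open>cop\<close> restricted to forests with distinct decorations is the
  coproduct. The counit laws and coassociativity compare multiplicative maps, so they need to be
  checked only on the \<open>\<bullet>x\<bullet>\<close> and under \<open>B\<^sup>+\<close>; the latter uses
  \<open>cop (B\<^sup>+ F) = (B\<^sup>+ \<otimes> id) (cop F) + \<bullet> \<otimes> B\<^sup>+ F\<close>.
\<close>

section \<open>Linear algebra on bases\<close>

lemma lookup_scale [simp]: "Poly_Mapping.lookup (scale c v) b = c * Poly_Mapping.lookup v b"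
  by (simp add: scale_def Poly_Mapping.map.rep_eq when_def)

lemma scale_add_right: "scale c (v + v') = scale c v + scale c v'"
  by (rule poly_mapping_eqI) (simp add: lookup_add algebra_simps)

lemma scale_add_left: "scale (c + d) v = scale c v + scale d v"
  by (rule poly_mapping_eqI) (simp add: lookup_add algebra_simps)

lemma scale_scale [simp]: "scale c (scale d v) = scale (c * d) v"
  by (rule poly_mapping_eqI) (simp add: algebra_simps)

lemma scale_one [simp]: "scale 1 v = v"
  by (rule poly_mapping_eqI) simp

lemma scale_zero_left [simp]: "scale 0 v = 0"
  by (rule poly_mapping_eqI) simp

lemma scale_zero_right [simp]: "scale c 0 = 0"
  by (rule poly_mapping_eqI) simp

lemma scale_sum: "scale c (sum f A) = (\<Sum>a\<in>A. scale c (f a))"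
  by (induction A rule: infinite_finite_induct) (simp_all add: scale_add_right)

lemma keys_scale_subset: "Poly_Mapping.keys (scale c v) \<subseteq> Poly_Mapping.keys v"
  by (auto simp: in_keys_iff)

lemma keys_basis_vec [simp]: "Poly_Mapping.keys (basis_vec b :: 'b \<Rightarrow>\<^sub>0 'k::field) = {b}"
  by (simp add: basis_vec_def)

text \<open>Padding with zero coefficients lets vectors with different supports be expanded over one
  common finite set, as additivity requires.\<close>

lemma linext_superset:
  assumes "finite A" "Poly_Mapping.keys v \<subseteq> A"
  shows "linext f v = (\<Sum>a\<in>A. scale (Poly_Mapping.lookup v a) (f a))"
  unfolding linext_def
  using assms by (intro sum.mono_neutral_left) (auto simp: in_keys_iff)

lemma linext_add [simp]: "linext f (v + v') = linext f v + linext f v'"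
proof -
  let ?A = "Poly_Mapping.keys v \<union> Poly_Mapping.keys v'"
  have "linext f u = (\<Sum>a\<in>?A. scale (Poly_Mapping.lookup u a) (f a))"
    if "u \<in> {v, v', v + v'}" for u
    using that Poly_Mapping.keys_add[of v v'] by (intro linext_superset) auto
  then show ?thesis
    by (simp add: lookup_add scale_add_left sum.distrib)
qed

lemma linext_scale [simp]: "linext f (scale c v) = scale c (linext f v)"
  by (subst linext_superset[OF finite_keys keys_scale_subset])
    (simp add: linext_def scale_sum)

lemma linext_zero [simp]: "linext f 0 = 0"
  by (simp add: linext_def)

lemma linext_basis_vec [simp]: "linext f (basis_vec b) = f b"
  by (simp add: linext_def) (simp add: basis_vec_def)

text \<open>Basis vectors span, so a linear identity reduces to its values on the basis; the other
  cases follow by linearity. Nested inductions treat bilinear and trilinear identities.\<close>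

lemma vec_induct [case_names zero basis_vec add scale]:
  fixes v :: "'b \<Rightarrow>\<^sub>0 'k::field"
  assumes "P 0" "\<And>b. P (basis_vec b)"
    and "\<And>u v. P u \<Longrightarrow> P v \<Longrightarrow> P (u + v)" "\<And>c v. P v \<Longrightarrow> P (scale c v)"
  shows "P v"
proof -
  have v: "v = (\<Sum>a\<in>Poly_Mapping.keys v. scale (Poly_Mapping.lookup v a) (basis_vec a))"
    by (rule poly_mapping_eqI)
      (auto simp: lookup_sum basis_vec_def lookup_single when_def if_distrib in_keys_iff
        cong: if_cong)
  have "P (\<Sum>a\<in>A. scale (Poly_Mapping.lookup v a) (basis_vec a))" if "finite A" for A
    using that by (induction A) (auto intro: assms)
  then show ?thesis
    by (subst v) simp
qed

lemma linext_fun_add [simp]: "linext (\<lambda>a. f a + g a) v = linext f v + linext g v"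
  by (induction v rule: vec_induct) (simp_all add: algebra_simps scale_add_right)

lemma linext_fun_scale [simp]: "linext (\<lambda>a. scale c (f a)) v = scale c (linext f v)"
  by (induction v rule: vec_induct) (simp_all add: scale_add_right mult.commute)

lemma linext_fun_zero [simp]: "linext (\<lambda>a. 0) v = 0"
  by (induction v rule: vec_induct) simp_all

lemma linext_id [simp]: "linext basis_vec v = v"
  by (induction v rule: vec_induct) simp_all

lemma linext_linext: "linext f (linext g v) = linext (\<lambda>a. linext f (g a)) v"
  by (induction v rule: vec_induct) simp_all

lemma linext_commute:
  "linext (\<lambda>a. linext (\<lambda>b. f a b) y) x = linext (\<lambda>b. linext (\<lambda>a. f a b) x) y"
  by (induction x rule: vec_induct) simp_all

lemma linext_cong:
  "(\<And>b. b \<in> Poly_Mapping.keys v \<Longrightarrow> f b = g b) \<Longrightarrow> linext f v = linext g v"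
  by (simp add: linext_def)

lemma keys_linext:
  "Poly_Mapping.keys (linext f v) \<subseteq> (\<Union>a\<in>Poly_Mapping.keys v. Poly_Mapping.keys (f a))"
  unfolding linext_def
  using keys_sum keys_scale_subset by (force simp: subset_iff)

lemma keys_linextE:
  assumes "c \<in> Poly_Mapping.keys (linext f v)"
  obtains a where "a \<in> Poly_Mapping.keys v" "c \<in> Poly_Mapping.keys (f a)"
  using assms keys_linext by fastforce

section \<open>Tensor products and bilinear multiplications\<close>

lemma tensor_basis_vec [simp]: "tensor (basis_vec a) (basis_vec b) = basis_vec (a, b)"
  by (simp add: tensor_def)

lemma tensor_add_left [simp]: "tensor (x + x') y = tensor x y + tensor x' y"
  and tensor_scale_left [simp]: "tensor (scale c x) y = scale c (tensor x y)"
  and tensor_zero_left [simp]: "tensor 0 y = 0"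
  and tensor_add_right [simp]: "tensor x (y + y') = tensor x y + tensor x y'"
  and tensor_scale_right [simp]: "tensor x (scale c y) = scale c (tensor x y)"
  and tensor_zero_right [simp]: "tensor x 0 = 0"
  by (simp_all add: tensor_def)

lemma keys_tensor: "Poly_Mapping.keys (tensor x y) \<subseteq> Poly_Mapping.keys x \<times> Poly_Mapping.keys y"
  unfolding tensor_def by (auto elim!: keys_linextE)

lemma linext_tensor: "linext f (tensor x y) = linext (\<lambda>a. linext (\<lambda>b. f (a, b)) y) x"
  by (simp add: tensor_def linext_linext)

lemma tensor_linext_left: "tensor (linext f x) y = linext (\<lambda>a. tensor (f a) y) x"
  by (simp add: tensor_def linext_linext)

lemma tensor_linext_right: "tensor x (linext f y) = linext (\<lambda>b. tensor x (f b)) y"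
  by (induction y rule: vec_induct) simp_all

lemma tensor_map_basis [simp]: "tensor_map f g (a, b) = tensor (f a) (g b)"
  by (simp add: tensor_map_def)

lemma linext_tensor_map [simp]:
  "linext (tensor_map f g) (tensor x y) = tensor (linext f x) (linext g y)"
  by (simp add: linext_tensor tensor_linext_left tensor_linext_right
      linext_commute[of "\<lambda>a b. tensor (f a) (g b)"])

lemma times_by_basis_vec [simp]: "times_by m (basis_vec a) (basis_vec b) = m (a, b)"
  and times_by_add_left [simp]: "times_by m (x + x') y = times_by m x y + times_by m x' y"
  and times_by_scale_left [simp]: "times_by m (scale c x) y = scale c (times_by m x y)"
  and times_by_zero_left [simp]: "times_by m 0 y = 0"
  and times_by_add_right [simp]: "times_by m x (y + y') = times_by m x y + times_by m x y'"
  and times_by_scale_right [simp]: "times_by m x (scale c y) = scale c (times_by m x y)"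
  and times_by_zero_right [simp]: "times_by m x 0 = 0"
  by (simp_all add: times_by_def)

lemma times_by_linext_left: "times_by m (linext f x) y = linext (\<lambda>a. times_by m (f a) y) x"
  by (simp add: times_by_def tensor_linext_left linext_linext)

lemma times_by_linext_right: "times_by m x (linext f y) = linext (\<lambda>b. times_by m x (f b)) y"
  by (simp add: times_by_def tensor_linext_right linext_linext)

lemma cauchy_mult_basis [simp]:
  "cauchy_mult m m' ((a, b), (c, d)) = tensor (m (a, c)) (m' (b, d))"
  by (simp add: cauchy_mult_def)

lemma times_by_cauchy_mult [simp]:
  "times_by (cauchy_mult m m') (tensor x y) (tensor x' y')
    = tensor (times_by m x x') (times_by m' y y')"
proof (induction x rule: vec_induct)
  case (basis_vec a)
  show ?case
  proof (induction x' rule: vec_induct)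
    case (basis_vec a')
    show ?case
    proof (induction y rule: vec_induct)
      case (basis_vec b)
      show ?case
        by (induction y' rule: vec_induct) simp_all
    qed simp_all
  qed simp_all
qed simp_all

text \<open>The generators are pure tensors of arbitrary vectors instead of basis pairs, so rules
  about \<open>tensor x y\<close> apply with both factors left opaque.\<close>

lemma tensor_induct [case_names zero tensor add scale]:
  fixes v :: "'a \<times> 'b \<Rightarrow>\<^sub>0 'k::field"
  assumes "P 0" "\<And>x y. P (tensor x y)"
    and "\<And>u v. P u \<Longrightarrow> P v \<Longrightarrow> P (u + v)" "\<And>c v. P v \<Longrightarrow> P (scale c v)"
  shows "P v"
proof (induction v rule: vec_induct)
  case (basis_vec b)
  then show ?case
    using assms(2)[of "basis_vec (fst b)" "basis_vec (snd b)"] by simp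
qed (auto intro: assms)

lemma cauchy_mult_assoc:
  assumes "\<And>x y z. times_by m (times_by m x y) z = times_by m x (times_by m y z)"
    and "\<And>x y z. times_by m' (times_by m' x y) z = times_by m' x (times_by m' y z)"
  shows "times_by (cauchy_mult m m') (times_by (cauchy_mult m m') x y) z
    = times_by (cauchy_mult m m') x (times_by (cauchy_mult m m') y z)"
proof (induction x rule: tensor_induct)
  case (tensor a a')
  show ?case
  proof (induction y rule: tensor_induct)
    case (tensor b b')
    show ?case
      by (induction z rule: tensor_induct) (simp_all add: assms)
  qed simp_all
qed simp_all

lemma cauchy_mult_unit:
  assumes "\<And>x. times_by m u x = x" "\<And>x. times_by m x u = x"
    and "\<And>x. times_by m' u' x = x" "\<And>x. times_by m' x u' = x"
  shows "times_by (cauchy_mult m m') (tensor u u') x = x"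
    and "times_by (cauchy_mult m m') x (tensor u u') = x"
  by (induction x rule: tensor_induct) (simp_all add: assms)

lemma times_by_tensor_map:
  assumes "\<And>x y. linext f (times_by m x y) = times_by n (linext f x) (linext f y)"
    and "\<And>x y. linext g (times_by m' x y) = times_by n' (linext g x) (linext g y)"
  shows "linext (tensor_map f g) (times_by (cauchy_mult m m') x y)
    = times_by (cauchy_mult n n') (linext (tensor_map f g) x) (linext (tensor_map f g) y)"
proof (induction x rule: tensor_induct)
  case (tensor a a')
  show ?case
    by (induction y rule: tensor_induct) (simp_all add: assms)
qed simp_all

lemma linext_times_by_of_basis:
  assumes "\<And>a b. linext f (m (a, b)) = times_by n (f a) (f b)"
  shows "linext f (times_by m x y) = times_by n (linext f x) (linext f y)"
proof (induction x rule: vec_induct)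
  case (basis_vec a)
  show ?case
    by (induction y rule: vec_induct) (simp_all add: assms)
qed simp_all

section \<open>The product of forests\<close>

abbreviation mul :: "'k::field \<Rightarrow> ('x forest \<Rightarrow>\<^sub>0 'k) \<Rightarrow> ('x forest \<Rightarrow>\<^sub>0 'k) \<Rightarrow> ('x forest \<Rightarrow>\<^sub>0 'k)"
  where "mul w \<equiv> times_by (ADF_mult w)"

lemma ADF_mult_basis [simp]: "ADF_mult w (F, G) = diamond w F G"
  by (simp add: ADF_mult_def)

text \<open>On basis forests this is the recursion defining the product of two grafted trees; both
  sides are bilinear.\<close>

lemma rota_baxter_mul:
  "mul w (linext B_plus a) (linext B_plus b)
    = linext B_plus (mul w (linext B_plus a) b) + linext B_plus (mul w a (linext B_plus b))
      + scale w (linext B_plus (mul w a b))"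
proof (induction a rule: vec_induct)
  case (basis_vec A)
  show ?case
  proof (induction b rule: vec_induct)
    case (basis_vec C)
    show ?case
      by (simp add: B_plus_def linext_linext)
  qed (simp_all add: scale_add_right algebra_simps)
qed (simp_all add: scale_add_right algebra_simps)

lemma diamond_bullet_left [simp]: "diamond w bullet G = basis_vec G"
  by (cases G) (simp_all add: bullet_def)

lemma diamond_tree_Leaf_right [simp]: "diamond_tree w T Leaf = basis_vec T"
  by (cases T) simp_all

lemma diamond_bullet_right [simp]: "diamond w F bullet = basis_vec F"
  unfolding bullet_def by (induction F rule: forest.induct[of "\<lambda>_. True"]) simp_all

lemma mul_unit [simp]:
  "mul w (basis_vec bullet) x = x" "mul w x (basis_vec bullet) = x"
  by (induction x rule: vec_induct) simp_all

section \<open>Associativity of the product\<close>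

lemma mul_Angle_left:
  "mul w (linext (\<lambda>H. basis_vec (Angle T x H)) a) b
    = linext (\<lambda>H. basis_vec (Angle T x H)) (mul w a b)"
proof (induction a rule: vec_induct)
  case (basis_vec A)
  show ?case
    by (induction b rule: vec_induct) simp_all
qed simp_all

text \<open>Mirror image of \<open>Angle\<close>: the angle \<open>y\<close> and the forest
  \<open>G\<close> are placed to the right of the last tree. Forests are built from the left, so
  this end needs a recursion.\<close>

fun attach :: "'x \<Rightarrow> 'x forest \<Rightarrow> 'x forest \<Rightarrow> 'x forest" where
  "attach y G (Single T) = Angle T y G"
| "attach y G (Angle T x F) = Angle T x (attach y G F)"

text \<open>Multiplication changes only the junction between the last tree of the left factor and
  the first tree of the right one, so whatever follows that first tree is carried along.\<close>

lemma mul_attach_right: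
  "mul w a (linext (\<lambda>H. basis_vec (attach y G H)) b)
    = linext (\<lambda>H. basis_vec (attach y G H)) (mul w a b)"
proof (induction b rule: vec_induct)
  case (basis_vec C)
  show ?case
  proof (induction a rule: vec_induct)
    case (basis_vec A)
    have "diamond w A (attach y G C) = linext (\<lambda>H. basis_vec (attach y G H)) (diamond w A C)"
    proof (induction A rule: forest.induct[of "\<lambda>_. True"])
      case (Single T)
      then show ?case by (cases C) (simp_all add: linext_linext)
    qed (simp_all add: linext_linext)
    then show ?case by simp
  qed simp_all
qed simp_all

text \<open>Induction on total size. An angle in \<open>F\<close> or \<open>H\<close> lets an outer
  part be stripped off; an angle in \<open>G\<close> separates the two junctions; three trees are
  handled by the Rota-Baxter identity.\<close>

lemma diamond_assoc:
  fixes w :: "'k::field" and F G H :: "'x forest"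
  shows "mul w (diamond w F G) (basis_vec H) = mul w (basis_vec F) (diamond w G H)"
proof (induction "size F + size G + size H" arbitrary: F G H rule: less_induct)
  case less
  show ?case
  proof (cases F)
    case (Angle T x F')
    then have "mul w (diamond w F' G) (basis_vec H) = mul w (basis_vec F') (diamond w G H)"
      by (intro less) simp
    then show ?thesis
      using mul_Angle_left[of w T x "basis_vec F'" "diamond w G H"]
      by (simp add: Angle mul_Angle_left)
  next
    case F: (Single T)
    show ?thesis
    proof (cases G)
      case (Angle T' y G')
      \<comment> \<open>\<open>F\<close> merges with the first tree of \<open>G\<close> and
        \<open>H\<close> with the rest after the angle \<open>y\<close>, so the two merges are
        independent and commute.\<close>
      then show ?thesis
        by (simp add: F times_by_linext_left times_by_linext_right
            linext_commute[of "\<lambda>S K. basis_vec (Angle S y K)"])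
    next
      case G: (Single T')
      show ?thesis
      proof (cases H)
        case (Angle T'' z H')
        \<comment> \<open>Here \<open>H\<close> is \<open>attach z H' (Single T'')\<close>.
          Splitting \<open>H'\<close> shows that its size is positive, so the total size
          drops.\<close>
        then have "mul w (diamond w F G) (basis_vec (Single T''))
            = mul w (basis_vec F) (diamond w G (Single T''))"
          by (intro less) (cases H', simp_all)
        then show ?thesis
          using mul_attach_right[of w "diamond w F G" z H' "basis_vec (Single T'')"]
            mul_attach_right[of w "basis_vec G" z H' "basis_vec (Single T'')"]
          by (simp add: Angle mul_attach_right)
      next
        case H: (Single T'')
        consider "T = Leaf" | "T' = Leaf" | "T'' = Leaf"
          | A B C where "T = Graft A" "T' = Graft B" "T'' = Graft C"
          by (metis tree.exhaust)
        then show ?thesis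
        proof cases
          case 4
          define a b c :: "'x forest \<Rightarrow>\<^sub>0 'k"
            where abc: "a = basis_vec A" "b = basis_vec B" "c = basis_vec C"
          have B: "basis_vec F = linext B_plus a" "basis_vec G = linext B_plus b"
              "basis_vec H = linext B_plus c"
            by (simp_all add: abc F G H 4 B_plus_def)
          have IH: "mul w (mul w (basis_vec A') (basis_vec B')) (basis_vec C')
              = mul w (basis_vec A') (mul w (basis_vec B') (basis_vec C'))"
            if "size A' + size B' + size C' < size F + size G + size H" for A' B' C' :: "'x forest"
            using less[OF that] by simp
          \<comment> \<open>One instance for each way of removing at least one of the three roots;
            each removal decreases the total size.\<close>
          have
            "mul w (mul w a b) c = mul w a (mul w b c)"
            "mul w (mul w a b) (linext B_plus c) = mul w a (mul w b (linext B_plus c))"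
            "mul w (mul w a (linext B_plus b)) c = mul w a (mul w (linext B_plus b) c)"
            "mul w (mul w (linext B_plus a) b) c = mul w (linext B_plus a) (mul w b c)"
            "mul w (mul w a (linext B_plus b)) (linext B_plus c)
              = mul w a (mul w (linext B_plus b) (linext B_plus c))"
            "mul w (mul w (linext B_plus a) b) (linext B_plus c)
              = mul w (linext B_plus a) (mul w b (linext B_plus c))"
            "mul w (mul w (linext B_plus a) (linext B_plus b)) c
              = mul w (linext B_plus a) (mul w (linext B_plus b) c)"
            unfolding B[symmetric] unfolding abc
            by (rule IH, simp add: F G H 4)+
          note IHs = this
          have "mul w (mul w (linext B_plus a) (linext B_plus b)) (linext B_plus c)
              = mul w (linext B_plus a) (mul w (linext B_plus b) (linext B_plus c))"
            \<comment> \<open>After expansion, the terms with nested \<open>B_plus\<close> on the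
              left recombine to \<open>B_plus\<close> of the left side of the seventh identity,
              hence the \<open>arg_cong\<close>. The fifth plays the same part for the terms on the
              right.\<close>
            using IHs(5,6) arg_cong[OF IHs(7), of "linext B_plus"]
            by (simp add: rota_baxter_mul IHs(1-4) algebra_simps scale_add_right)
          then show ?thesis
            by (simp flip: B)
        qed (simp_all add: F G H flip: bullet_def)
      qed
    qed
  qed
qed

lemma mul_assoc: "mul w (mul w x y) z = mul w x (mul w y z)"
proof (induction x rule: vec_induct)
  case (basis_vec F)
  show ?case
  proof (induction y rule: vec_induct)
    case (basis_vec G)
    show ?case
      by (induction z rule: vec_induct) (simp_all add: diamond_assoc)
  qed simp_all
qed simp_all

text \<open>Merging two trees at the junction neither creates, loses nor permutes angles. This is
  what places products in the component of the disjoint union.\<close>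

lemma
  fixes w :: "'k::field" and T T' :: "'x tree" and F G :: "'x forest"
  shows angles_diamond_tree:
      "S \<in> Poly_Mapping.keys (diamond_tree w T T') \<Longrightarrow> tree_angles S = tree_angles T @ tree_angles T'"
    and angles_diamond:
      "H \<in> Poly_Mapping.keys (diamond w F G) \<Longrightarrow> angles H = angles F @ angles G"
  by (induction w T T' and w F G arbitrary: S and H rule: diamond_tree_diamond.induct)
    (auto elim!: keys_linextE dest!: subsetD[OF Poly_Mapping.keys_add] subsetD[OF keys_scale_subset])

text \<open>The recursion for the product never inspects decorations.\<close>

lemma
  fixes w :: "'k::field" and T T' :: "'x tree" and F G :: "'x forest"
  shows diamond_tree_map_tree: "diamond_tree w (map_tree \<sigma> T) (map_tree \<sigma> T')
      = linext (\<lambda>S. basis_vec (map_tree \<sigma> S)) (diamond_tree w T T')"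
    and diamond_map_forest: "diamond w (map_forest \<sigma> F) (map_forest \<sigma> G)
      = linext (\<lambda>H. basis_vec (map_forest \<sigma> H)) (diamond w F G)"
  by (induction w T T' and w F G rule: diamond_tree_diamond.induct)
    (simp_all add: linext_linext)

section \<open>The coproduct on all forests\<close>

abbreviation mul2 ::
    "'k::field \<Rightarrow> ('x forest \<times> 'x forest \<Rightarrow>\<^sub>0 'k) \<Rightarrow> ('x forest \<times> 'x forest \<Rightarrow>\<^sub>0 'k)
      \<Rightarrow> ('x forest \<times> 'x forest \<Rightarrow>\<^sub>0 'k)"
  where "mul2 w \<equiv> times_by (cauchy_mult (ADF_mult w) (ADF_mult w))"

section \<open>The counit as a scalar-valued character\<close>

definition eps :: "('x forest \<Rightarrow>\<^sub>0 'k::field) \<Rightarrow> 'k"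
  where "eps v = Poly_Mapping.lookup (linext ADF_counit v) ()"

lemma eps_linear [simp]:
  "eps 0 = 0" "eps (u + v) = eps u + eps v" "eps (scale c v) = c * eps v"
  by (simp_all add: eps_def lookup_add)

lemma eps_basis_vec: "eps (basis_vec F) = (if F = bullet then 1 else 0)"
  by (simp add: eps_def ADF_counit_def) (simp add: basis_vec_def)

lemma eps_bullet [simp]: "eps (basis_vec bullet) = 1"
  by (simp add: eps_basis_vec)

lemma unit_vec_eq: "v = scale (Poly_Mapping.lookup v ()) (basis_vec ())"
  by (rule poly_mapping_eqI) (simp add: basis_vec_def)

text \<open>The target of the counit is one-dimensional, so the scalar \<open>eps\<close> carries
  all its information.\<close>

lemma linext_ADF_counit: "linext ADF_counit v = scale (eps v) (basis_vec ())"
  unfolding eps_def by (rule unit_vec_eq)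

lemma eps_eq_0: "bullet \<notin> Poly_Mapping.keys v \<Longrightarrow> eps v = 0"
  by (auto simp: eps_def linext_def lookup_sum ADF_counit_def intro!: sum.neutral)

lemma eps_B_plus [simp]: "eps (linext B_plus v) = 0"
  by (induction v rule: vec_induct) (simp_all add: B_plus_def eps_basis_vec bullet_def)

text \<open>Such a product either contains an angle between adjacent trees or is a combination of
  grafted trees; \<open>bullet\<close> is of neither form.\<close>

lemma bullet_notin_keys_diamond:
  assumes "F \<noteq> bullet" "G \<noteq> bullet"
  shows "bullet \<notin> Poly_Mapping.keys (diamond w F G)"
proof (cases F)
  case F: (Single T)
  then obtain A where A: "T = Graft A"
    using assms by (cases T) (auto simp: bullet_def)
  show ?thesis
  proof (cases G)
    case (Single T')
    then obtain B where "T' = Graft B"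
      using assms by (cases T') (auto simp: bullet_def)
    then show ?thesis
      by (auto simp: F A Single bullet_def elim!: keys_linextE
          dest!: subsetD[OF Poly_Mapping.keys_add] subsetD[OF keys_scale_subset])
  qed (auto simp: F bullet_def elim!: keys_linextE)
qed (auto simp: bullet_def elim!: keys_linextE)

text \<open>\<open>bullet\<close> is the unit and a product of two other forests avoids it, so the
  only nonzero contribution comes from the pair of bullets.\<close>

lemma eps_mul [simp]: "eps (mul w x y) = eps x * eps y"
proof (induction x rule: vec_induct)
  case (basis_vec F)
  show ?case
  proof (induction y rule: vec_induct)
    case (basis_vec G)
    show ?case
      using eps_eq_0[OF bullet_notin_keys_diamond, of F G w]
      by (cases "F = bullet"; cases "G = bullet") (auto simp: eps_basis_vec)
  qed (simp_all add: algebra_simps)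
qed (simp_all add: algebra_simps)

section \<open>The Rota-Baxter operator on the tensor square\<close>

lemma ADF2_operator_tensor [simp]:
  "linext ADF2_operator (tensor a b)
    = tensor (linext B_plus a) b + scale (eps a) (tensor (basis_vec bullet) (linext B_plus b))"
proof (induction a rule: vec_induct)
  case (basis_vec A)
  show ?case
    by (induction b rule: vec_induct)
      (simp_all add: ADF2_operator_def eps_def scale_add_right algebra_simps)
qed (simp_all add: scale_add_right scale_add_left algebra_simps)

text \<open>On pure tensors both sides expand by the Rota-Baxter identity in each factor. The terms
  match because \<open>eps\<close> is multiplicative and vanishes on \<open>B_plus\<close>.\<close>

lemma rota_baxter_mul2:
  "mul2 w (linext ADF2_operator x) (linext ADF2_operator y)
    = linext ADF2_operator (mul2 w (linext ADF2_operator x) y)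
      + linext ADF2_operator (mul2 w x (linext ADF2_operator y))
      + scale w (linext ADF2_operator (mul2 w x y))"
proof (induction x rule: tensor_induct)
  case (tensor a b)
  show ?case
  proof (induction y rule: tensor_induct)
    case (tensor a' b')
    show ?case
      by (simp add: scale_add_right rota_baxter_mul algebra_simps)
  qed (simp_all add: scale_add_right algebra_simps)
qed (simp_all add: scale_add_right algebra_simps)

lemma mul2_assoc: "mul2 w (mul2 w x y) z = mul2 w x (mul2 w y z)"
  by (intro cauchy_mult_assoc mul_assoc)

abbreviation unit2 :: "'x forest \<times> 'x forest \<Rightarrow>\<^sub>0 'k::field"
  where "unit2 \<equiv> tensor (basis_vec bullet) (basis_vec bullet)"

text \<open>The unit appears as a basis pair because simplification turns a tensor of basis vectors
  into one.\<close>

lemma mul2_unit [simp]: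
  "mul2 w (basis_vec (bullet, bullet)) x = x" "mul2 w x (basis_vec (bullet, bullet)) = x"
  unfolding tensor_basis_vec[symmetric] by (rule cauchy_mult_unit; simp)+

section \<open>The recursive coproduct and its multiplicativity\<close>

definition primitive :: "'x \<Rightarrow> 'x forest \<times> 'x forest \<Rightarrow>\<^sub>0 'k::field"
  where "primitive x = tensor (basis_vec (bullet2 x)) (basis_vec bullet)
    + tensor (basis_vec bullet) (basis_vec (bullet2 x))"

primrec cop_tree :: "'k::field \<Rightarrow> 'x tree \<Rightarrow> 'x forest \<times> 'x forest \<Rightarrow>\<^sub>0 'k"
  and cop :: "'k::field \<Rightarrow> 'x forest \<Rightarrow> 'x forest \<times> 'x forest \<Rightarrow>\<^sub>0 'k" where
  "cop_tree w Leaf = unit2"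
| "cop_tree w (Graft F) = linext ADF2_operator (cop w F)"
| "cop w (Single T) = cop_tree w T"
| "cop w (Angle T x F) = mul2 w (mul2 w (cop_tree w T) (primitive x)) (cop w F)"

lemma cop_bullet [simp]: "cop w bullet = unit2"
  by (simp add: bullet_def)

lemma cop_bullet2 [simp]: "cop w (bullet2 x) = primitive x"
  by (simp add: bullet2_def)

lemma cop_B_plus [simp]: "linext (cop w) (linext B_plus v) = linext ADF2_operator (linext (cop w) v)"
  by (induction v rule: vec_induct) (simp_all add: B_plus_def)

text \<open>The two leaves of \<open>bullet2 x\<close> are absorbed as units by the neighbouring
  trees. Thus products and \<open>B_plus\<close> generate every forest from \<open>bullet\<close>
  and the \<open>bullet2 x\<close>.\<close>

lemma Angle_eq_mul:
  "mul w (mul w (basis_vec (Single T)) (basis_vec (bullet2 x))) (basis_vec F)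
    = basis_vec (Angle T x F)"
  using diamond_bullet_left[of w F] by (simp add: bullet2_def flip: bullet_def)

text \<open>Angles are stripped from either factor by associativity of \<open>mul2\<close>. For two
  grafted trees the Rota-Baxter identities before and after applying \<open>cop\<close> correspond
  term by term.\<close>

lemma cop_diamond: "linext (cop w) (diamond w F G) = mul2 w (cop w F) (cop w G)"
proof (induction "size F + size G" arbitrary: F G rule: less_induct)
  case less
  show ?case
  proof (cases F)
    case (Angle T x F')
    have "linext (cop w) (diamond w F' G) = mul2 w (cop w F') (cop w G)"
      by (rule less) (simp add: Angle)
    then show ?thesis
      by (simp add: Angle linext_linext mul2_assoc flip: times_by_linext_right)
  next
    case F: (Single T)
    show ?thesis
    proof (cases G)
      case (Angle T' y G')
      have "linext (cop w) (diamond w F (Single T')) = mul2 w (cop w F) (cop w (Single T'))"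
        \<comment> \<open>Splitting \<open>G'\<close> shows that its size is positive, so dropping
          it decreases the measure.\<close>
        by (rule less) (cases G', simp_all add: Angle)
      then have "linext (cop_tree w) (diamond_tree w T T') = mul2 w (cop_tree w T) (cop_tree w T')"
        by (simp add: F linext_linext)
      then show ?thesis
        by (simp add: F Angle linext_linext mul2_assoc flip: times_by_linext_left)
    next
      case G: (Single T')
      consider "T = Leaf" | "T' = Leaf" | A B where "T = Graft A" "T' = Graft B"
        by (metis tree.exhaust)
      then show ?thesis
      proof cases
        case 3
        have IH: "linext (cop w) (diamond w A B) = mul2 w (cop w A) (cop w B)"
            "linext (cop w) (diamond w F B) = mul2 w (cop w F) (cop w B)"
            "linext (cop w) (diamond w A G) = mul2 w (cop w A) (cop w G)"
          by (rule less, simp add: F G 3)+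
        \<comment> \<open>The forests \<open>F\<close> and \<open>G\<close> are the grafts of
          \<open>A\<close> and \<open>B\<close>, so this is the Rota-Baxter identity at two basis
          vectors.\<close>
        have "diamond w F G = linext B_plus (diamond w F B) + linext B_plus (diamond w A G)
            + scale w (linext B_plus (diamond w A B))"
          using rota_baxter_mul[of w "basis_vec A" "basis_vec B"] by (simp add: B_plus_def F G 3)
        then have "linext (cop w) (diamond w F G)
            = linext ADF2_operator (mul2 w (cop w F) (cop w B))
              + linext ADF2_operator (mul2 w (cop w A) (cop w G))
              + scale w (linext ADF2_operator (mul2 w (cop w A) (cop w B)))"
          by (simp add: IH)
        also have "\<dots> = mul2 w (cop w F) (cop w G)"
          by (simp add: F G 3 rota_baxter_mul2)
        finally show ?thesis .
      qed (simp_all add: F G flip: bullet_def)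
    qed
  qed
qed

lemma cop_mul: "linext (cop w) (mul w x y) = mul2 w (linext (cop w) x) (linext (cop w) y)"
  by (rule linext_times_by_of_basis) (simp add: cop_diamond)

section \<open>Counit laws\<close>

abbreviation counit_left :: "('x forest \<times> 'x forest \<Rightarrow>\<^sub>0 'k::field) \<Rightarrow> ('x forest \<Rightarrow>\<^sub>0 'k)"
  where "counit_left v \<equiv>
    linext (\<lambda>(_, b). basis_vec b) (linext (tensor_map ADF_counit basis_vec) v)"

abbreviation counit_right :: "('x forest \<times> 'x forest \<Rightarrow>\<^sub>0 'k::field) \<Rightarrow> ('x forest \<Rightarrow>\<^sub>0 'k)"
  where "counit_right v \<equiv>
    linext (\<lambda>(a, _). basis_vec a) (linext (tensor_map basis_vec ADF_counit) v)"

lemma counit_left_tensor: "counit_left (tensor a b) = scale (eps a) b"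
  unfolding linext_tensor_map by (simp add: linext_ADF_counit linext_tensor)

lemma counit_right_tensor: "counit_right (tensor a b) = scale (eps b) a"
  unfolding linext_tensor_map by (simp add: linext_ADF_counit linext_tensor)

text \<open>Holds because \<open>eps\<close> is a character: the scalars multiply while the
  surviving factors are multiplied by \<open>mul\<close>.\<close>

lemma counit_left_mul2: "counit_left (mul2 w x y) = mul w (counit_left x) (counit_left y)"
proof (induction x rule: tensor_induct)
  case (tensor a b)
  show ?case
    by (induction y rule: tensor_induct)
      (simp_all add: counit_left_tensor mult.commute del: linext_tensor_map)
qed simp_all

lemma counit_right_mul2: "counit_right (mul2 w x y) = mul w (counit_right x) (counit_right y)"
proof (induction x rule: tensor_induct)
  case (tensor a b)
  show ?case
    by (induction y rule: tensor_induct)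
      (simp_all add: counit_right_tensor mult.commute del: linext_tensor_map)
qed simp_all

text \<open>The summand with \<open>B_plus\<close> on the left is killed by \<open>eps\<close>; in
  the other one \<open>eps\<close> of \<open>bullet\<close> is 1.\<close>

lemma counit_left_ADF2_operator:
  "counit_left (linext ADF2_operator v) = linext B_plus (counit_left v)"
  by (induction v rule: tensor_induct) (simp_all add: counit_left_tensor del: linext_tensor_map)

text \<open>Here the summand with \<open>B_plus\<close> on the right is the one that
  \<open>eps\<close> kills.\<close>

lemma counit_right_ADF2_operator:
  "counit_right (linext ADF2_operator v) = linext B_plus (counit_right v)"
  by (induction v rule: tensor_induct) (simp_all add: counit_right_tensor del: linext_tensor_map)

text \<open>Treating trees as one-tree forests replaces the mutual induction by a single
  predicate.\<close>

lemma forest_induct [case_names bullet Graft Angle]: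
  assumes "P bullet" "\<And>F. P F \<Longrightarrow> P (Single (Graft F))"
    and "\<And>T x F. P (Single T) \<Longrightarrow> P F \<Longrightarrow> P (Angle T x F)"
  shows "P F"
  by (rule forest.induct[of "\<lambda>T. P (Single T)" P]) (use assms in \<open>auto simp: bullet_def\<close>)

lemma counit_left_primitive: "counit_left (primitive x) = basis_vec (bullet2 x)"
  unfolding primitive_def linext_add counit_left_tensor
  by (simp add: eps_basis_vec bullet_def bullet2_def)

lemma counit_left_cop: "counit_left (cop w F) = basis_vec F"
proof (induction F rule: forest_induct)
  case bullet
  then show ?case
    using counit_left_tensor[of "basis_vec bullet" "basis_vec bullet"] by simp
next
  case (Graft F)
  then show ?case
    by (simp add: counit_left_ADF2_operator B_plus_def)
next
  case (Angle T x F)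
  then show ?case
    using Angle_eq_mul[of w T x F] by (simp add: counit_left_mul2 counit_left_primitive)
qed

lemma counit_right_primitive: "counit_right (primitive x) = basis_vec (bullet2 x)"
  unfolding primitive_def linext_add counit_right_tensor
  by (simp add: eps_basis_vec bullet_def bullet2_def)

lemma counit_right_cop: "counit_right (cop w F) = basis_vec F"
proof (induction F rule: forest_induct)
  case bullet
  then show ?case
    using counit_right_tensor[of "basis_vec bullet" "basis_vec bullet"] by simp
next
  case (Graft F)
  then show ?case
    by (simp add: counit_right_ADF2_operator B_plus_def)
next
  case (Angle T x F)
  then show ?case
    using Angle_eq_mul[of w T x F] by (simp add: counit_right_mul2 counit_right_primitive)
qed

section \<open>Coassociativity\<close>

abbreviation reassoc :: "(('a \<times> 'b) \<times> 'c \<Rightarrow>\<^sub>0 'k::field) \<Rightarrow> ('a \<times> 'b \<times> 'c \<Rightarrow>\<^sub>0 'k)"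
  where "reassoc \<equiv> linext (\<lambda>((a, b), c). basis_vec (a, (b, c)))"

lemma reassoc_tensor [simp]: "reassoc (tensor (tensor x y) z) = tensor x (tensor y z)"
proof (induction x rule: vec_induct)
  case (basis_vec a)
  show ?case
  proof (induction y rule: vec_induct)
    case (basis_vec b)
    show ?case
      by (induction z rule: vec_induct) simp_all
  qed simp_all
qed simp_all

lemma tensor3_induct [case_names zero tensor add scale]:
  fixes v :: "('a \<times> 'b) \<times> 'c \<Rightarrow>\<^sub>0 'k::field"
  assumes "P 0" "\<And>x y z. P (tensor (tensor x y) z)"
    and "\<And>u v. P u \<Longrightarrow> P v \<Longrightarrow> P (u + v)" "\<And>c v. P v \<Longrightarrow> P (scale c v)"
  shows "P v"
proof (induction v rule: tensor_induct)
  case (tensor u z)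
  show ?case
    by (induction u rule: tensor_induct) (auto intro: assms)
qed (auto intro: assms)

lemma reassoc_cauchy_mult:
  "reassoc (times_by (cauchy_mult (cauchy_mult m m') m'') x y)
    = times_by (cauchy_mult m (cauchy_mult m' m'')) (reassoc x) (reassoc y)"
proof (induction x rule: tensor3_induct)
  case (tensor a b c)
  show ?case
    by (induction y rule: tensor3_induct) simp_all
qed simp_all

text \<open>The scalar \<open>eps\<close> in the second summand of the operator is exactly what
  \<open>counit_left\<close> produces. This form makes the left counit law applicable.\<close>

lemma ADF2_operator_eq:
  "linext ADF2_operator v
    = linext (tensor_map B_plus basis_vec) v
      + tensor (basis_vec bullet) (linext B_plus (counit_left v))"
proof (induction v rule: tensor_induct)
  case (tensor x y)
  show ?case
    unfolding counit_left_tensor by simp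
qed (simp_all add: scale_add_right algebra_simps)

text \<open>The Hochschild 1-cocycle equation for \<open>B_plus\<close>, as in Connes-Kreimer type
  Hopf algebras; \<open>counit_left_cop\<close> turns the second summand into
  \<open>B_plus F\<close>.\<close>

lemma cop_Graft:
  "cop w (Single (Graft F)) = linext (tensor_map B_plus basis_vec) (cop w F)
    + tensor (basis_vec bullet) (B_plus F)"
  by (simp add: ADF2_operator_eq counit_left_cop)

lemma linext_cop_B_plus:
  "linext (cop w) (linext B_plus v) = linext (tensor_map B_plus basis_vec) (linext (cop w) v)
    + tensor (basis_vec bullet) (linext B_plus v)"
proof (induction v rule: vec_induct)
  case (basis_vec F)
  have "linext (cop w) (B_plus F) = cop w (Single (Graft F))"
    by (simp add: B_plus_def)
  then show ?case
    by (simp add: cop_Graft del: cop_B_plus cop.simps)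
qed (simp_all add: scale_add_right algebra_simps del: cop_B_plus)

abbreviation cop_left ::
    "'k::field \<Rightarrow> ('x forest \<times> 'x forest \<Rightarrow>\<^sub>0 'k)
      \<Rightarrow> ('x forest \<times> 'x forest \<times> 'x forest \<Rightarrow>\<^sub>0 'k)"
  where "cop_left w v \<equiv> reassoc (linext (tensor_map (cop w) basis_vec) v)"

abbreviation cop_right ::
    "'k::field \<Rightarrow> ('x forest \<times> 'x forest \<Rightarrow>\<^sub>0 'k)
      \<Rightarrow> ('x forest \<times> 'x forest \<times> 'x forest \<Rightarrow>\<^sub>0 'k)"
  where "cop_right w v \<equiv> linext (tensor_map basis_vec (cop w)) v"

abbreviation mul3 ::
    "'k::field \<Rightarrow> ('x forest \<times> 'x forest \<times> 'x forest \<Rightarrow>\<^sub>0 'k) \<Rightarrow> ('x forest \<times> 'x forest \<times> 'x forest \<Rightarrow>\<^sub>0 'k)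
      \<Rightarrow> ('x forest \<times> 'x forest \<times> 'x forest \<Rightarrow>\<^sub>0 'k)"
  where "mul3 w \<equiv> times_by (cauchy_mult (ADF_mult w) (cauchy_mult (ADF_mult w) (ADF_mult w)))"

text \<open>A composite of algebra morphisms: \<open>cop\<close> on the first factor, then
  reassociation of the triple tensor product.\<close>

lemma cop_left_mul2: "cop_left w (mul2 w x y) = mul3 w (cop_left w x) (cop_left w y)"
  unfolding reassoc_cauchy_mult[symmetric]
  by (subst times_by_tensor_map) (simp_all add: cop_mul)

lemma cop_right_mul2: "cop_right w (mul2 w x y) = mul3 w (cop_right w x) (cop_right w y)"
  by (rule times_by_tensor_map) (simp_all add: cop_mul)

lemma reassoc_B_plus:
  "reassoc (tensor (linext (tensor_map B_plus basis_vec) x) z)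
    = linext (tensor_map B_plus basis_vec) (reassoc (tensor x z))"
  by (induction x rule: tensor_induct) simp_all

text \<open>The cocycle equation \<open>linext_cop_B_plus\<close> applied in the first tensor
  factor.\<close>

lemma cop_left_B_plus:
  "cop_left w (linext (tensor_map B_plus basis_vec) v)
    = linext (tensor_map B_plus basis_vec) (cop_left w v)
      + tensor (basis_vec bullet) (linext (tensor_map B_plus basis_vec) v)"
  by (induction v rule: tensor_induct)
    (simp_all add: linext_cop_B_plus reassoc_B_plus scale_add_right algebra_simps del: cop_B_plus)

lemma cop_right_B_plus:
  "cop_right w (linext (tensor_map B_plus basis_vec) v)
    = linext (tensor_map B_plus basis_vec) (cop_right w v)"
  by (induction v rule: tensor_induct) simp_all

text \<open>For a grafted forest the induction hypothesis matches the terms with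
  \<open>B_plus\<close> in the first factor. The terms starting with \<open>bullet\<close> match by
  the cocycle equation for \<open>cop w (Single (Graft F))\<close>. Products are covered by
  multiplicativity of both sides.\<close>

lemma cop_coassoc: "cop_left w (cop w F) = cop_right w (cop w F)"
proof (induction F rule: forest_induct)
  case bullet
  then show ?case by simp
next
  case (Graft F)
  have "cop_left w (tensor (basis_vec bullet) (B_plus F))
      = tensor (basis_vec bullet) (tensor (basis_vec bullet) (B_plus F))"
    unfolding linext_tensor_map by (simp only: linext_basis_vec cop_bullet reassoc_tensor linext_id)
  moreover have "cop_right w (tensor (basis_vec bullet) (B_plus F))
      = tensor (basis_vec bullet) (cop w (Single (Graft F)))"
    unfolding linext_tensor_map by (simp add: B_plus_def del: cop.simps)
  ultimately show ?case
    using Graft by (simp add: cop_Graft cop_left_B_plus cop_right_B_plus del: cop.simps)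
next
  case (Angle T x F)
  have "cop_left w (primitive x) = cop_right w (primitive x)"
    by (simp add: primitive_def)
  then show ?case
    using Angle by (simp add: cop_left_mul2 cop_right_mul2)
qed

section \<open>Decorations occurring in the coproduct\<close>

lemma keys_times_byE:
  assumes "c \<in> Poly_Mapping.keys (times_by m x y)"
  obtains a b where "a \<in> Poly_Mapping.keys x" "b \<in> Poly_Mapping.keys y"
    "c \<in> Poly_Mapping.keys (m (a, b))"
  using assms unfolding times_by_def by (elim keys_linextE) (auto dest!: subsetD[OF keys_tensor])

lemma angles_bullet [simp]: "angles bullet = []"
  by (simp add: bullet_def)

text \<open>The decorations of a product of pairs interleave across the two factors, so multisets
  are tracked instead of lists. For homogeneous arguments these multisets add up.\<close>

lemma angles_mul2:
  assumes "(H, K) \<in> Poly_Mapping.keys (mul2 w x y)"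
    and "\<And>A B. (A, B) \<in> Poly_Mapping.keys x \<Longrightarrow> mset (angles A) + mset (angles B) = M"
    and "\<And>A B. (A, B) \<in> Poly_Mapping.keys y \<Longrightarrow> mset (angles A) + mset (angles B) = N"
  shows "mset (angles H) + mset (angles K) = M + N"
proof -
  from assms(1) obtain A B A' B' where *: "(A, B) \<in> Poly_Mapping.keys x" "(A', B') \<in> Poly_Mapping.keys y"
    "(H, K) \<in> Poly_Mapping.keys (tensor (diamond w A A') (diamond w B B'))"
    by (elim keys_times_byE) auto
  then have "angles H = angles A @ angles A'" "angles K = angles B @ angles B'"
    using subsetD[OF keys_tensor *(3)] by (auto dest: angles_diamond)
  then show ?thesis
    using assms(2)[OF *(1)] assms(3)[OF *(2)] by auto
qed

lemma angles_cop:
  "(H, K) \<in> Poly_Mapping.keys (cop w F) \<Longrightarrow> mset (angles H) + mset (angles K) = mset (angles F)"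
proof (induction F arbitrary: H K rule: forest_induct)
  case bullet
  then show ?case by simp
next
  case (Graft F)
  then show ?case
    by (auto simp: cop_Graft B_plus_def simp del: cop.simps elim!: keys_linextE
        dest!: subsetD[OF Poly_Mapping.keys_add])
next
  case (Angle T x F)
  have primitive: "mset (angles A) + mset (angles B) = {#x#}"
    if "(A, B) \<in> Poly_Mapping.keys (primitive x)" for A B
    using that
    by (auto simp: primitive_def bullet_def bullet2_def dest!: subsetD[OF Poly_Mapping.keys_add])
  have "mset (angles A) + mset (angles B) = mset (angles (Single T)) + {#x#}"
    if "(A, B) \<in> Poly_Mapping.keys (mul2 w (cop w (Single T)) (primitive x))" for A B
    using that Angle.IH(1) primitive by (rule angles_mul2)
  then have "mset (angles H) + mset (angles K) = mset (angles (Single T)) + {#x#} + mset (angles F)"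
    by (rule angles_mul2[OF Angle.prems[unfolded cop.simps]]) (use Angle.IH(2) in auto)
  then show ?case by simp
qed

section \<open>Naturality under relabelling\<close>

abbreviation relabel :: "('x \<Rightarrow> 'y) \<Rightarrow> 'x forest \<Rightarrow> 'y forest \<Rightarrow>\<^sub>0 'k::field"
  where "relabel \<sigma> F \<equiv> basis_vec (map_forest \<sigma> F)"

abbreviation relabel2 :: "('x \<Rightarrow> 'y) \<Rightarrow> 'x forest \<times> 'x forest \<Rightarrow> 'y forest \<times> 'y forest \<Rightarrow>\<^sub>0 'k::field"
  where "relabel2 \<sigma> \<equiv> tensor_map (relabel \<sigma>) (relabel \<sigma>)"

lemma relabel_mul:
  "linext (relabel \<sigma>) (mul w x y) = mul w (linext (relabel \<sigma>) x) (linext (relabel \<sigma>) y)"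
  by (rule linext_times_by_of_basis) (simp add: diamond_map_forest)

lemma relabel2_mul2:
  "linext (relabel2 \<sigma>) (mul2 w x y) = mul2 w (linext (relabel2 \<sigma>) x) (linext (relabel2 \<sigma>) y)"
  by (intro times_by_tensor_map relabel_mul)

lemma relabel_B_plus:
  "linext (relabel \<sigma>) (linext B_plus x) = linext B_plus (linext (relabel \<sigma>) x)"
  by (induction x rule: vec_induct) (simp_all add: B_plus_def)

lemma map_forest_eq_bullet_iff [simp]: "map_forest \<sigma> F = bullet \<longleftrightarrow> F = bullet"
proof (cases F)
  case (Single T)
  then show ?thesis by (cases T) (simp_all add: bullet_def)
qed (simp add: bullet_def)

lemma eps_relabel [simp]: "eps (linext (relabel \<sigma>) x) = eps x"
  by (induction x rule: vec_induct) (simp_all add: eps_basis_vec)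

lemma relabel_bullet [simp]: "map_forest \<sigma> bullet = bullet"
  by simp

text \<open>Relabelling commutes with \<open>B_plus\<close> and preserves \<open>eps\<close>, since
  only \<open>bullet\<close> is relabelled to \<open>bullet\<close>.\<close>

lemma relabel2_ADF2_operator:
  "linext (relabel2 \<sigma>) (linext ADF2_operator x) = linext ADF2_operator (linext (relabel2 \<sigma>) x)"
  by (induction x rule: tensor_induct) (simp_all add: relabel_B_plus)

lemma cop_map_forest: "cop w (map_forest \<sigma> F) = linext (relabel2 \<sigma>) (cop w F)"
proof (induction F rule: forest_induct)
  case (Graft F)
  then show ?case
    by (simp add: relabel2_ADF2_operator)
next
  case (Angle T x F)
  then show ?case
    by (simp add: relabel2_mul2 primitive_def bullet2_def)
qed simp

section \<open>The twisted bialgebra\<close>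

lemma component_linext:
  assumes "v \<in> component P X" "\<And>b. b \<in> basis P X \<Longrightarrow> f b \<in> component Q Y"
  shows "linext f v \<in> component Q Y"
  using assms by (fastforce simp: component_def elim!: keys_linextE)

lemma linext_cong_component:
  assumes "v \<in> component P X" "\<And>b. b \<in> basis P X \<Longrightarrow> f b = g b"
  shows "linext f v = linext g v"
  using assms by (intro linext_cong) (auto simp: component_def)

lemma basis_vec_in_component [simp]: "basis_vec b \<in> component P X \<longleftrightarrow> b \<in> basis P X"
  by (simp add: component_def)

lemma basis_ADF: "basis ADF X = {F. distinct (angles F) \<and> set (angles F) = X}"
  by (simp add: ADF_def)

lemma transport_ADF: "transport ADF \<sigma> = relabel \<sigma>"
  by (simp add: ADF_def)

lemma transport_ADF2: "transport (ADF \<otimes>\<^sub>S ADF) \<sigma> = relabel2 \<sigma>"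
  by (simp add: cauchy_def transport_ADF)

text \<open>The decomposition of \<open>X\<close> in the Cauchy product is determined by the pair:
  its parts are the sets of decorations of the two forests.\<close>

lemma basis_ADF2:
  "basis (ADF \<otimes>\<^sub>S ADF) X = {(F, G). distinct (angles F @ angles G) \<and> set (angles F @ angles G) = X}"
  by (auto simp: cauchy_def basis_ADF)

lemma
  fixes T :: "'x tree" and F :: "'x forest"
  shows tree_angles_map_tree: "tree_angles (map_tree \<sigma> T) = map \<sigma> (tree_angles T)"
    and angles_map_forest: "angles (map_forest \<sigma> F) = map \<sigma> (angles F)"
  by (induction T and F) simp_all

lemma
  fixes T :: "'x tree" and F :: "'x forest"
  shows set_tree_eq_angles: "set_tree T = set (tree_angles T)"
    and set_forest_eq_angles: "set_forest F = set (angles F)"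
  by (induction T and F) simp_all

lemma relabel_in_component:
  assumes "bij_betw \<sigma> X Y" "F \<in> basis ADF X"
  shows "relabel \<sigma> F \<in> component ADF Y"
  using assms by (auto simp: basis_ADF angles_map_forest distinct_map bij_betw_def)

section \<open>The species and its twisted algebra structure\<close>

lemma is_species_ADF: "is_species (ADF :: ('x, 'x forest, 'k::field) species)"
  unfolding is_species_def
proof (intro conjI allI impI ballI)
  fix X Y :: "'x set" and \<sigma> :: "'x \<Rightarrow> 'x" and F :: "'x forest"
  assume "bij_betw \<sigma> X Y" "F \<in> basis (ADF :: ('x, 'x forest, 'k) species) X"
  then show "transport ADF \<sigma> F \<in> component (ADF :: ('x, 'x forest, 'k) species) Y"
    unfolding transport_ADF by (rule relabel_in_component)
next
  fix X :: "'x set" and \<sigma> \<tau> :: "'x \<Rightarrow> 'x" and F :: "'x forest"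
  assume "\<forall>x\<in>X. \<sigma> x = \<tau> x" "F \<in> basis (ADF :: ('x, 'x forest, 'k) species) X"
  then have "map_forest \<sigma> F = map_forest \<tau> F"
    by (intro forest.map_cong) (auto simp: basis_ADF set_forest_eq_angles)
  then show "(transport ADF \<sigma> F :: 'x forest \<Rightarrow>\<^sub>0 'k) = transport ADF \<tau> F"
    by (simp add: transport_ADF)
qed (auto simp: basis_ADF transport_ADF linext_linext forest.map_id0 forest.map_comp)

lemma diamond_in_component:
  assumes "F \<in> basis ADF X" "G \<in> basis ADF Y" "X \<inter> Y = {}"
  shows "diamond w F G \<in> component ADF (X \<union> Y)"
  using assms by (auto simp: component_def basis_ADF dest!: angles_diamond)

lemma twisted_algebra_ADF:
  "twisted_algebra (ADF :: ('x, 'x forest, 'k::field) species) (ADF_mult w) (basis_vec bullet)"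
  unfolding twisted_algebra_def species_morphism_def
proof (intro conjI allI impI ballI is_species_ADF)
  fix X :: "'x set" and z :: "'x forest \<times> 'x forest"
  assume "z \<in> basis ((ADF :: ('x, 'x forest, 'k) species) \<otimes>\<^sub>S (ADF :: ('x, 'x forest, 'k) species)) X"
  then show "ADF_mult w z \<in> component ADF X"
    by (auto simp: component_def basis_ADF2 basis_ADF dest!: angles_diamond)
next
  fix \<sigma> :: "'x \<Rightarrow> 'x" and v :: "'x forest \<times> 'x forest \<Rightarrow>\<^sub>0 'k"
  show "linext (ADF_mult w) (linext (transport (ADF \<otimes>\<^sub>S ADF) \<sigma>) v)
      = linext (transport ADF \<sigma>) (linext (ADF_mult w) v)"
    unfolding transport_ADF transport_ADF2
    by (induction v rule: vec_induct) (auto simp: diamond_map_forest)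
qed (simp_all add: mul_assoc basis_ADF)

section \<open>Counit and coproduct as morphisms\<close>

lemma counit_mul:
  "linext ADF_counit (mul w x y) = times_by unit_species_mult (linext ADF_counit x) (linext ADF_counit y)"
  by (simp add: linext_ADF_counit unit_species_mult_def mult.commute)

lemma species_morphism_counit:
  "species_morphism (ADF :: ('x, 'x forest, 'k::field) species) unit_species ADF_counit"
  unfolding species_morphism_def
  by (auto simp: unit_species_def ADF_counit_def component_def basis_ADF transport_ADF
      linext_ADF_counit)

text \<open>The zero values follow the convention in \<open>ADF_coproduct\<close>, so that equality
  with it can be proved as an equality of functions.\<close>

definition distinct_cop :: "'k::field \<Rightarrow> 'x forest \<Rightarrow> 'x forest \<times> 'x forest \<Rightarrow>\<^sub>0 'k"
  where "distinct_cop w F = (if distinct (angles F) then cop w F else 0)"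

lemma linext_distinct_cop:
  "v \<in> component ADF X \<Longrightarrow> linext (distinct_cop w) v = linext (cop w) v"
  by (erule linext_cong_component) (simp add: distinct_cop_def basis_ADF)

lemma cop_in_component:
  assumes "F \<in> basis ADF X"
  shows "cop w F \<in> component (ADF \<otimes>\<^sub>S ADF) X"
proof -
  have "distinct (angles H @ angles K) \<and> set (angles H @ angles K) = X"
    if "(H, K) \<in> Poly_Mapping.keys (cop w F)" for H K
  proof -
    \<comment> \<open>Equality of multisets gives both distinctness of the joint list and its set of
      entries.\<close>
    have "mset (angles H @ angles K) = mset (angles F)"
      using angles_cop[OF that] by simp
    then show ?thesis
      using assms mset_eq_imp_distinct_iff mset_eq_setD unfolding basis_ADF by blast
  qed
  then show ?thesis
    unfolding component_def basis_ADF2 by blast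
qed

lemma species_morphism_distinct_cop:
  "species_morphism (ADF :: ('x, 'x forest, 'k::field) species) (ADF \<otimes>\<^sub>S ADF) (distinct_cop w)"
  unfolding species_morphism_def
proof (intro conjI allI impI ballI)
  fix X :: "'x set" and F :: "'x forest"
  assume "F \<in> basis (ADF :: ('x, 'x forest, 'k) species) X"
  then show "distinct_cop w F \<in> component (ADF \<otimes>\<^sub>S ADF) X"
    using cop_in_component[of F X w] by (simp add: distinct_cop_def basis_ADF)
next
  fix X Y :: "'x set" and \<sigma> :: "'x \<Rightarrow> 'x" and v :: "'x forest \<Rightarrow>\<^sub>0 'k"
  assume \<sigma>: "bij_betw \<sigma> X Y" and v: "v \<in> component ADF X"
  \<comment> \<open>Injectivity of \<sigma> on \<open>X\<close> keeps decorations distinct, so after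
    transport \<open>distinct_cop\<close> still agrees with \<open>cop\<close>.\<close>
  from v have "linext (transport ADF \<sigma>) v \<in> component (ADF :: ('x, 'x forest, 'k) species) Y"
    unfolding transport_ADF by (rule component_linext) (rule relabel_in_component[OF \<sigma>])
  then have "linext (distinct_cop w) (linext (transport ADF \<sigma>) v)
      = linext (cop w) (linext (relabel \<sigma>) v)"
    by (simp add: linext_distinct_cop transport_ADF)
  also have "\<dots> = linext (relabel2 \<sigma>) (linext (cop w) v)"
    by (induction v rule: vec_induct) (simp_all add: cop_map_forest)
  finally show "linext (distinct_cop w) (linext (transport ADF \<sigma>) v)
      = linext (transport (ADF \<otimes>\<^sub>S ADF) \<sigma>) (linext (distinct_cop w) v)"
    using v by (simp add: linext_distinct_cop transport_ADF2)
qed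

lemma twisted_algebra_morphism_distinct_cop:
  "twisted_algebra_morphism (ADF :: ('x, 'x forest, 'k::field) species) (ADF_mult w) (basis_vec bullet)
    (ADF \<otimes>\<^sub>S ADF) (cauchy_mult (ADF_mult w) (ADF_mult w)) unit2 (distinct_cop w)"
  unfolding twisted_algebra_morphism_def
proof (intro conjI allI impI ballI species_morphism_distinct_cop)
  fix X Y :: "'x set" and x y :: "'x forest \<Rightarrow>\<^sub>0 'k"
  assume X: "X \<inter> Y = {}" and x: "x \<in> component ADF X" and y: "y \<in> component ADF Y"
  \<comment> \<open>Disjointness of \<open>X\<close> and \<open>Y\<close> keeps the decorations of
    the product distinct, which allows \<open>distinct_cop\<close> to be replaced by
    \<open>cop\<close>.\<close>
  have "mul w x y \<in> component ADF (X \<union> Y)"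
    using x y X diamond_in_component[of _ X _ Y w] unfolding component_def
    by (fastforce elim!: keys_times_byE)
  then show "linext (distinct_cop w) (mul w x y)
      = mul2 w (linext (distinct_cop w) x) (linext (distinct_cop w) y)"
    using x y by (simp add: linext_distinct_cop cop_mul)
qed (simp add: distinct_cop_def)

lemma rota_baxter_morphism_distinct_cop:
  "rota_baxter_morphism (ADF :: ('x, 'x forest, 'k::field) species) (ADF_mult w) (basis_vec bullet) B_plus
    (ADF \<otimes>\<^sub>S ADF) (cauchy_mult (ADF_mult w) (ADF_mult w)) unit2 ADF2_operator (distinct_cop w)"
  unfolding rota_baxter_morphism_def
proof (intro conjI allI impI ballI twisted_algebra_morphism_distinct_cop)
  fix X :: "'x set" and v :: "'x forest \<Rightarrow>\<^sub>0 'k"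
  assume v: "v \<in> component ADF X"
  then have "linext B_plus v \<in> component (ADF :: ('x, 'x forest, 'k) species) X"
    by (rule component_linext) (simp add: B_plus_def basis_ADF)
  then show "linext (distinct_cop w) (linext B_plus v) = linext ADF2_operator (linext (distinct_cop w) v)"
    using v by (simp add: linext_distinct_cop)
qed

text \<open>Induction along the generation of forests by \<open>B_plus\<close> and products with the
  \<open>bullet2 x\<close>. Subforests of a forest with distinct decorations have disjoint supports,
  so the morphism laws apply at each stage.\<close>

lemma rota_baxter_morphism_unique:
  fixes w :: "'k::field"
  assumes \<Delta>: "rota_baxter_morphism (ADF :: ('x, 'x forest, 'k) species) (ADF_mult w)
      (basis_vec bullet) B_plus (ADF \<otimes>\<^sub>S ADF) (cauchy_mult (ADF_mult w) (ADF_mult w)) unit2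
      ADF2_operator \<Delta>"
    and primitive: "\<And>x. \<Delta> (bullet2 x) = primitive x"
  shows "distinct (angles F) \<Longrightarrow> \<Delta> F = cop w F"
proof (induction F rule: forest_induct)
  case bullet
  have "linext \<Delta> (basis_vec bullet) = unit2"
    using \<Delta> unfolding rota_baxter_morphism_def twisted_algebra_morphism_def by blast
  then show ?case by simp
next
  case (Graft F)
  then have "basis_vec F \<in> component (ADF :: ('x, 'x forest, 'k) species) (set (angles F))"
    by (simp add: basis_ADF)
  then have "linext \<Delta> (linext B_plus (basis_vec F)) = linext ADF2_operator (linext \<Delta> (basis_vec F))"
    using \<Delta> unfolding rota_baxter_morphism_def by blast
  then show ?case
    using Graft by (simp add: B_plus_def)
next
  case (Angle T x F)
  have mult: "linext \<Delta> (mul w u v) = mul2 w (linext \<Delta> u) (linext \<Delta> v)"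
    if "finite X" "finite Y" "X \<inter> Y = {}" "u \<in> component ADF X" "v \<in> component ADF Y" for X Y u v
    using \<Delta> that unfolding rota_baxter_morphism_def twisted_algebra_morphism_def by blast
  have T: "basis_vec (Single T) \<in> component (ADF :: ('x, 'x forest, 'k) species) (set (tree_angles T))"
    and x: "basis_vec (bullet2 x) \<in> component (ADF :: ('x, 'x forest, 'k) species) {x}"
    and F: "basis_vec F \<in> component (ADF :: ('x, 'x forest, 'k) species) (set (angles F))"
    using Angle.prems by (auto simp: basis_ADF bullet2_def)
  \<comment> \<open>Multiplicativity holds only between components over disjoint sets, so the
    intermediate product must be located before the second multiplication.\<close>
  have Tx: "mul w (basis_vec (Single T)) (basis_vec (bullet2 x))
      \<in> component ADF (set (tree_angles T) \<union> {x})"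
    using T x Angle.prems diamond_in_component[of "Single T" "set (tree_angles T)" "bullet2 x" "{x}" w]
    by simp
  have "\<Delta> (Angle T x F)
      = linext \<Delta> (mul w (mul w (basis_vec (Single T)) (basis_vec (bullet2 x))) (basis_vec F))"
    unfolding Angle_eq_mul by simp
  also have "\<dots> = mul2 w (linext \<Delta> (mul w (basis_vec (Single T)) (basis_vec (bullet2 x)))) (\<Delta> F)"
    using Angle.prems by (subst mult[OF _ _ _ Tx F]) auto
  also have "\<dots> = mul2 w (mul2 w (\<Delta> (Single T)) (primitive x)) (\<Delta> F)"
    using Angle.prems by (subst mult[OF _ _ _ T x]) (auto simp: primitive)
  finally show ?case
    using Angle by simp
qed

text \<open>Existence and uniqueness for the definite description: uniqueness on distinct
  decorations comes from the generators, and the zero convention fixes all other values.\<close>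

lemma ADF_coproduct_eq: "ADF_coproduct w = distinct_cop w"
  unfolding ADF_coproduct_def primitive_def[symmetric]
proof (rule the_equality)
  have primitive: "distinct_cop w (bullet2 x) = primitive x" for x
    using cop_bullet2[of w x] by (simp add: distinct_cop_def bullet2_def)
  show "rota_baxter_morphism ADF (ADF_mult w) (basis_vec bullet) B_plus (ADF \<otimes>\<^sub>S ADF)
      (cauchy_mult (ADF_mult w) (ADF_mult w)) unit2 ADF2_operator (distinct_cop w) \<and>
    (\<forall>x. distinct_cop w (bullet2 x) = primitive x) \<and>
    (\<forall>F. \<not> distinct (angles F) \<longrightarrow> distinct_cop w F = 0)"
    by (intro conjI allI impI rota_baxter_morphism_distinct_cop primitive)
      (simp add: distinct_cop_def)
next
  fix \<Delta>
  assume "rota_baxter_morphism ADF (ADF_mult w) (basis_vec bullet) B_plus (ADF \<otimes>\<^sub>S ADF)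
      (cauchy_mult (ADF_mult w) (ADF_mult w)) unit2 ADF2_operator \<Delta> \<and>
    (\<forall>x. \<Delta> (bullet2 x) = primitive x) \<and> (\<forall>F. \<not> distinct (angles F) \<longrightarrow> \<Delta> F = 0)"
  then show "\<Delta> = distinct_cop w"
    using rota_baxter_morphism_unique[of w \<Delta>] by (auto simp: distinct_cop_def fun_eq_iff)
qed

section \<open>Coalgebra axioms and the bialgebra\<close>

lemma linext_tensor_map_distinct_cop:
  assumes "v \<in> component (ADF \<otimes>\<^sub>S ADF) X"
  shows "linext (tensor_map (distinct_cop w) basis_vec) v = linext (tensor_map (cop w) basis_vec) v"
    and "linext (tensor_map basis_vec (distinct_cop w)) v = linext (tensor_map basis_vec (cop w)) v"
  by (rule linext_cong_component[OF assms]; auto simp: basis_ADF2 distinct_cop_def)+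

lemma twisted_coalgebra_ADF:
  "twisted_coalgebra (ADF :: ('x, 'x forest, 'k::field) species) (distinct_cop w) ADF_counit"
  unfolding twisted_coalgebra_def
proof (intro conjI[OF is_species_ADF] conjI[OF species_morphism_distinct_cop]
    conjI[OF species_morphism_counit] allI impI ballI)
  fix X :: "'x set" and v :: "'x forest \<Rightarrow>\<^sub>0 'k"
  assume v: "v \<in> component ADF X"
  then have cop_v: "linext (cop w) v \<in> component (ADF \<otimes>\<^sub>S ADF) X"
    by (rule component_linext) (rule cop_in_component)
  \<comment> \<open>Stated for \<open>cop\<close> and not \<open>distinct_cop\<close>, because the
    induction on \<open>v\<close> runs through vectors outside the component; the restriction is
    restored afterwards.\<close>
  have "cop_left w (linext (cop w) v) = cop_right w (linext (cop w) v)"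
    and "counit_left (linext (cop w) v) = v"
    and "counit_right (linext (cop w) v) = v"
    by (induction v rule: vec_induct)
      (simp_all add: cop_coassoc counit_left_cop counit_right_cop)
  then show "reassoc (linext (tensor_map (distinct_cop w) basis_vec) (linext (distinct_cop w) v))
        = linext (tensor_map basis_vec (distinct_cop w)) (linext (distinct_cop w) v) \<and>
      counit_left (linext (distinct_cop w) v) = v \<and> counit_right (linext (distinct_cop w) v) = v"
    by (simp only: linext_distinct_cop[OF v] linext_tensor_map_distinct_cop[OF cop_v] simp_thms)
qed

theorem theorem3p11:
  fixes w :: "'k::field_char_0"
  shows "twisted_bialgebra (ADF :: ('x, 'x forest, 'k) species)
    (ADF_mult w) (basis_vec bullet) (ADF_coproduct w) ADF_counit"
  unfolding twisted_bialgebra_def ADF_coproduct_eq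
proof (intro conjI twisted_algebra_ADF twisted_coalgebra_ADF twisted_algebra_morphism_distinct_cop)
  show "twisted_algebra_morphism (ADF :: ('x, 'x forest, 'k) species) (ADF_mult w) (basis_vec bullet)
      unit_species unit_species_mult (basis_vec ()) ADF_counit"
    unfolding twisted_algebra_morphism_def
    by (intro conjI species_morphism_counit allI impI ballI counit_mul) (simp add: ADF_counit_def)
qed

end
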